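(* Let $G$ be a finite group and $p$ the smallest prime divisor of $|G|$. If $\Pr(G) = \frac{p^2+p-1}{p^3}$, then the non-commuting graph $\mathcal{A}_G$ is L-integral.
   Context: For a finite group $G$, $\Pr(G) = |\{(x,y) \in G \times G : xy = yx\}|/|G|^2$ is the commuting probability, i.e. the probability that two randomly chosen elements of $G$ commute. For a finite non-abelian group $G$ with centre $Z(G)$, the non-commuting graph $\mathcal{A}_G$ is the simple undirected graph with vertex set $G \setminus Z(G)$ in which two vertices $x,y$ are adjacent if and only if $xy \neq yx$. A finite graph is L-integral if all eigenvalues of its Laplacian matrix $D - A$ ($D$ the degree matrix, $A$ the adjacency matrix) are integers. *)

theory Defs
  imports
    "HOL-Computational_Algebra.Primes"
    "HOL-Algebra.Coset"
    "Graph_Theory.Pair_Digraph"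
    "Jordan_Normal_Form.Char_Poly"
begin

definition commuting_probability :: "('a, 'b) monoid_scheme \<Rightarrow> real" where
  "commuting_probability G =
     real (card {(x, y) \<in> carrier G \<times> carrier G. x \<otimes>\<^bsub>G\<^esub> y = y \<otimes>\<^bsub>G\<^esub> x}) / (real (Coset.order G))\<^sup>2"

definition group_center :: "('a, 'b) monoid_scheme \<Rightarrow> 'a set" where
  "group_center G = {z \<in> carrier G. \<forall>x \<in> carrier G. z \<otimes>\<^bsub>G\<^esub> x = x \<otimes>\<^bsub>G\<^esub> z}"

text \<open>
  Finite simple undirected graphs are rendered, as in \<^theory>\<open>Graph_Theory.Pair_Digraph\<close>, by
  the locale \<^locale>\<open>pair_graph\<close>: finite symmetric loop-free digraphs whose arcs are ordered
  pairs of vertices.  An edge between \<open>x\<close> and \<open>y\<close> is the pair of arcs \<open>(x, y)\<close>, \<open>(y, x)\<close>, so the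
  degree of a vertex is its \<^const>\<open>out_degree\<close>.
\<close>

definition non_commuting_graph :: "('a, 'b) monoid_scheme \<Rightarrow> 'a pair_pre_digraph" where
  "non_commuting_graph G =
     \<lparr>pverts = carrier G - group_center G,
      parcs = {(x, y). x \<in> carrier G - group_center G \<and> y \<in> carrier G - group_center G \<and>
                       x \<otimes>\<^bsub>G\<^esub> y \<noteq> y \<otimes>\<^bsub>G\<^esub> x}\<rparr>"

lemma pair_graph_non_commuting_graph:
  assumes "finite (carrier G)"
  shows "pair_graph (non_commuting_graph G)"
proof -
  let ?V = "carrier G - group_center G"
  have "parcs (non_commuting_graph G) \<subseteq> ?V \<times> ?V"
    by (auto simp: non_commuting_graph_def)
  moreover have "finite (?V \<times> ?V)"
    using assms by blast
  ultimately have "finite (parcs (non_commuting_graph G))"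
    by (rule finite_subset)
  then show ?thesis
    using assms
    by unfold_locales (auto simp: non_commuting_graph_def symmetric_def sym_def)
qed

text \<open>
  Matrices are indexed by natural numbers, so the matrices of a graph are taken with respect to
  a listing \<open>vs\<close> of its vertices.
\<close>

definition adjacency_matrix :: "'a pair_pre_digraph \<Rightarrow> 'a list \<Rightarrow> complex mat" where
  "adjacency_matrix g vs =
     mat (length vs) (length vs) (\<lambda>(i, j). if (vs ! i, vs ! j) \<in> parcs g then 1 else 0)"

definition degree_matrix :: "'a pair_pre_digraph \<Rightarrow> 'a list \<Rightarrow> complex mat" where
  "degree_matrix g vs =
     mat (length vs) (length vs)
       (\<lambda>(i, j). if i = j then of_nat (out_degree (with_proj g) (vs ! i)) else 0)"

definition laplacian_matrix :: "'a pair_pre_digraph \<Rightarrow> 'a list \<Rightarrow> complex mat" where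
  "laplacian_matrix g vs = degree_matrix g vs - adjacency_matrix g vs"

text \<open>
  Permuting the listing conjugates the Laplacian by a permutation matrix, so quantifying over all
  listings is the same as choosing one; a listing exists because \<^locale>\<open>pair_graph\<close> makes the
  vertex set finite.
\<close>

definition L_integral :: "'a pair_pre_digraph \<Rightarrow> bool" where
  "L_integral g \<longleftrightarrow> pair_graph g \<and>
     (\<forall>vs. distinct vs \<and> set vs = pverts g \<longrightarrow>
        (\<forall>k. eigenvalue (laplacian_matrix g vs) k \<longrightarrow> k \<in> \<int>))"

end

theory Submission
  imports Defs
begin

text \<open>
  Subgroups of \<open>G\<close> that are strictly contained in one another differ in order by a factor of at
  least \<open>p\<close>, so a non-central \<open>x\<close> satisfies \<open>p * |Z| \<le> |C(x)| \<le> |G| / p\<close>.  Bounding every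
  non-central centralizer by \<open>|G| / p\<close> in the sum that defines the commuting probability gives
  \<open>|G| \<le> p\<^sup>2 * |Z|\<close>, and therefore \<open>|C(x)| = p * |Z|\<close>.  If a non-central \<open>y\<close> commutes with \<open>x\<close>,
  then \<open>C(x) \<inter> C(y)\<close> lies strictly above \<open>Z\<close> and so is all of \<open>C(x)\<close>: commuting is transitive on
  non-central elements, and the non-commuting graph is complete multipartite.  For an eigenvector
  \<open>v\<close> of the Laplacian of such a graph on \<open>n\<close> vertices with eigenvalue \<open>k \<noteq> 0\<close>, the entries of \<open>v\<close>
  sum to \<open>0\<close>; the sum over a part is then multiplied by both \<open>k\<close> and \<open>n\<close>, so either \<open>k = n\<close> or
  all these sums vanish and \<open>k\<close> is the degree of a vertex.
\<close>

section \<open>Laplacian spectrum of complete multipartite graphs\<close>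

lemma out_degree_with_proj_listing:
  assumes "pair_graph g" and "distinct vs" and "set vs = pverts g"
  shows "out_degree (with_proj g) x = card {j. j < length vs \<and> (x, vs ! j) \<in> parcs g}"
proof -
  interpret pair_graph g by fact
  have "bij_betw (\<lambda>j. (x, vs ! j)) {j. j < length vs \<and> (x, vs ! j) \<in> parcs g}
          (out_arcs (with_proj g) x)"
    unfolding bij_betw_def
  proof
    show "inj_on (\<lambda>j. (x, vs ! j)) {j. j < length vs \<and> (x, vs ! j) \<in> parcs g}"
      using assms(2) by (auto simp: inj_on_def nth_eq_iff_index_eq)
    show "(\<lambda>j. (x, vs ! j)) ` {j. j < length vs \<and> (x, vs ! j) \<in> parcs g}
            = out_arcs (with_proj g) x"
    proof (intro equalityI subsetI)
      fix e assume "e \<in> out_arcs (with_proj g) x"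
      then have e: "e \<in> parcs g" "fst e = x" by auto
      then have "snd e \<in> set vs"
        using assms(3) head_in_verts[of e] by simp
      then obtain j where "j < length vs" "vs ! j = snd e"
        by (auto simp: in_set_conv_nth)
      with e show "e \<in> (\<lambda>j. (x, vs ! j)) ` {j. j < length vs \<and> (x, vs ! j) \<in> parcs g}"
        by (intro image_eqI[of _ _ j]) auto
    qed auto
  qed
  then show ?thesis
    by (simp add: out_degree_def bij_betw_same_card)
qed

text \<open>The diagonal entry counts the neighbours of \<open>vs ! i\<close>, so its product with
  \<open>v $ i\<close> can be spread over them, one copy of \<open>v $ i\<close> for each.\<close>

lemma laplacian_matrix_mult_vec_index:
  assumes "pair_graph g" and "distinct vs" and "set vs = pverts g"
    and v: "v \<in> carrier_vec (length vs)" and i: "i < length vs"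
  shows "(laplacian_matrix g vs *\<^sub>v v) $ i =
     (\<Sum>j<length vs. if (vs ! i, vs ! j) \<in> parcs g then v $ i - v $ j else 0)"
proof -
  let ?n = "length vs" and ?E = "\<lambda>j. (vs ! i, vs ! j) \<in> parcs g"
  have "(laplacian_matrix g vs *\<^sub>v v) $ i = (\<Sum>j<?n.
      ((if i = j then of_nat (card {j. j < ?n \<and> ?E j}) else 0) - (if ?E j then 1 else 0)) * v $ j)"
    using i v
    by (auto simp: laplacian_matrix_def degree_matrix_def adjacency_matrix_def scalar_prod_def
        out_degree_with_proj_listing[OF assms(1-3)] atLeast0LessThan intro!: sum.cong)
  also have "\<dots> = (\<Sum>j<?n. if j = i then of_nat (card {j. j < ?n \<and> ?E j}) * v $ j else 0)
      - (\<Sum>j<?n. if ?E j then v $ j else 0)"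
    unfolding sum_subtractf[symmetric] by (intro sum.cong) (auto simp: left_diff_distrib)
  also have "(\<Sum>j<?n. if j = i then of_nat (card {j. j < ?n \<and> ?E j}) * v $ j else 0)
      = of_nat (card {j. j < ?n \<and> ?E j}) * v $ i"
    using i by simp
  also have "of_nat (card {j. j < ?n \<and> ?E j}) * v $ i = (\<Sum>j<?n. if ?E j then v $ i else 0)"
    by (simp add: sum.inter_filter[symmetric])
  finally show ?thesis
    unfolding sum_subtractf[symmetric] by (simp add: if_distrib cong: if_cong)
qed

text \<open>As \<open>g\<close> is symmetric and loop-free, \<open>trans\<close> makes non-adjacency
  an equivalence relation on the vertices; its classes are the parts.\<close>

lemma L_integral_if_non_adjacency_transitive:
  assumes pg: "pair_graph g"
    and trans: "\<And>x y w. \<lbrakk>x \<in> pverts g; y \<in> pverts g; w \<in> pverts g;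
                   (x, y) \<notin> parcs g; (y, w) \<notin> parcs g\<rbrakk> \<Longrightarrow> (x, w) \<notin> parcs g"
  shows "L_integral g"
  unfolding L_integral_def
proof (intro conjI pg allI impI)
  fix vs :: "'a list" and k
  assume vs: "distinct vs \<and> set vs = pverts g"
    and ev: "eigenvalue (laplacian_matrix g vs) k"
  interpret pair_graph g by (rule pg)
  define n where "n = length vs"
  define E where "E = (\<lambda>i j. (vs ! i, vs ! j) \<in> parcs g)"
  define a :: "nat \<Rightarrow> nat \<Rightarrow> complex" where "a = (\<lambda>i j. if E i j then 1 else 0)"
  have E_sym: "E i j \<longleftrightarrow> E j i" for i j
    unfolding E_def using arcs_symmetric by blast
  have E_trans: "\<not> E i l" if "\<not> E i j" "\<not> E j l" "i < n" "j < n" "l < n" for i j l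
    using trans[of "vs ! i" "vs ! j" "vs ! l"] that vs nth_mem unfolding E_def n_def by blast
  \<comment> \<open>Vertices of the same part have the same neighbours.\<close>
  have E_cong: "E l j \<longleftrightarrow> E i j" if "\<not> E i l" "i < n" "j < n" "l < n" for i j l
    using E_trans that E_sym by blast
  have "dim_row (laplacian_matrix g vs) = n"
    by (simp add: laplacian_matrix_def adjacency_matrix_def n_def)
  then obtain v where v: "v \<in> carrier_vec n" "v \<noteq> 0\<^sub>v n"
    and eig: "laplacian_matrix g vs *\<^sub>v v = k \<cdot>\<^sub>v v"
    using ev unfolding eigenvalue_def eigenvector_def by auto
  have k_v: "k * v $ i = (\<Sum>j<n. a i j * (v $ i - v $ j))" if "i < n" for i
  proof -
    have "k * v $ i = (laplacian_matrix g vs *\<^sub>v v) $ i"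
      using eig v that by simp
    also have "\<dots> = (\<Sum>j<n. a i j * (v $ i - v $ j))"
      using laplacian_matrix_mult_vec_index[OF pg, of vs v i] vs v that
      by (auto simp: n_def a_def E_def intro!: sum.cong)
    finally show ?thesis .
  qed
  define S where "S = (\<Sum>j<n. v $ j)"
  \<comment> \<open>\<open>1 - a i j\<close> is the indicator of the part of \<open>i\<close>, which
    contains \<open>i\<close> itself. So \<open>B i\<close> sums \<open>v\<close> over that part,
    \<open>s i\<close> is its size and \<open>d i\<close> is the degree of \<open>i\<close>.\<close>
  define B where "B = (\<lambda>i. \<Sum>j<n. (1 - a i j) * v $ j)"
  define s where "s = (\<lambda>i. \<Sum>j<n. 1 - a i j)"
  define d where "d = (\<lambda>i. \<Sum>j<n. a i j)"
  have d_int: "d i \<in> \<int>" for i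
    unfolding d_def a_def by (intro Ints_sum) auto
  have s_d: "s i = of_nat n - d i" for i
    by (simp add: s_def d_def sum_subtractf)
  have SB: "(\<Sum>j<n. a i j * v $ j) = S - B i" for i
    by (simp add: S_def B_def algebra_simps sum_subtractf)
  have k_v': "k * v $ i = d i * v $ i - (S - B i)" if "i < n" for i
    using k_v[OF that] by (simp add: right_diff_distrib sum_subtractf SB d_def sum_distrib_right)
  \<comment> \<open>Summing \<open>k_v\<close> over all vertices gives zero: by symmetry of
    \<open>a\<close>, the two double sums agree after swapping indices.\<close>
  have k_S: "k * S = 0"
  proof -
    have "k * S = (\<Sum>i<n. \<Sum>j<n. a i j * v $ i) - (\<Sum>i<n. \<Sum>j<n. a i j * v $ j)"
      by (simp add: S_def sum_distrib_left k_v right_diff_distrib sum_subtractf)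
    also have "(\<Sum>i<n. \<Sum>j<n. a i j * v $ j) = (\<Sum>j<n. \<Sum>i<n. a i j * v $ j)"
      by (rule sum.swap)
    also have "\<dots> = (\<Sum>i<n. \<Sum>j<n. a i j * v $ i)"
      unfolding a_def using E_sym by (intro sum.cong) auto
    finally show ?thesis by simp
  qed
  \<comment> \<open>Sum \<open>k_v'\<close> over the part of \<open>i\<close>, where
    \<open>d\<close> and \<open>B\<close> are constant; then \<open>d i + s i = n\<close> collects
    the terms. Outside the part the factor \<open>1 - a i l\<close> vanishes.\<close>
  have k_B: "k * B i = of_nat n * B i - s i * S" if i: "i < n" for i
  proof -
    have "k * B i = (\<Sum>l<n. (1 - a i l) * (k * v $ l))"
      by (simp add: B_def sum_distrib_left mult_ac)
    also have "\<dots> = (\<Sum>l<n. (1 - a i l) * (d i * v $ l - (S - B i)))"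
    proof (intro sum.cong refl)
      fix l assume l: "l \<in> {..<n}"
      show "(1 - a i l) * (k * v $ l) = (1 - a i l) * (d i * v $ l - (S - B i))"
      proof (cases "E i l")
        case False
        with i l have "a l j = a i j" if "j < n" for j
          using E_cong[of i l j] that by (simp add: a_def)
        then have "d l = d i" "B l = B i"
          by (auto simp: d_def B_def)
        then show ?thesis using k_v'[of l] l by simp
      qed (simp add: a_def)
    qed
    also have "\<dots> = (\<Sum>l<n. d i * ((1 - a i l) * v $ l) - (1 - a i l) * (S - B i))"
      by (simp add: right_diff_distrib mult.left_commute)
    also have "\<dots> = d i * B i - s i * (S - B i)"
      unfolding B_def s_def sum_distrib_left sum_distrib_right by (rule sum_subtractf)
    finally show ?thesis by (simp add: s_d algebra_simps)
  qed
  obtain i where i: "i < n" "v $ i \<noteq> 0"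
    using v by (metis carrier_vecD eq_vecI index_zero_vec)
  show "k \<in> \<int>"
  proof (cases "k = 0 \<or> k = of_nat n")
    case False
    then have "S = 0" using k_S by simp
    moreover from this have "B i = 0" using k_B[OF i(1)] False by simp
    ultimately have "k = d i" using k_v'[OF i(1)] i(2) by simp
    then show ?thesis using d_int by simp
  qed auto
qed

section \<open>Centralizers, the centre and indices of subgroups\<close>

definition element_centralizer :: "('a, 'b) monoid_scheme \<Rightarrow> 'a \<Rightarrow> 'a set" where
  "element_centralizer G x = {y \<in> carrier G. x \<otimes>\<^bsub>G\<^esub> y = y \<otimes>\<^bsub>G\<^esub> x}"

context group
begin

lemma subgroup_element_centralizer:
  assumes x: "x \<in> carrier G"
  shows "subgroup (element_centralizer G x) G"
proof (rule subgroupI)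
  show "element_centralizer G x \<noteq> {}"
    using x by (auto simp: element_centralizer_def)
  fix y assume y: "y \<in> element_centralizer G x"
  then have y': "y \<in> carrier G" "x \<otimes> y = y \<otimes> x" by (auto simp: element_centralizer_def)
  have "x \<otimes> inv y = inv y \<otimes> (y \<otimes> x) \<otimes> inv y"
    using x y' by (simp add: m_assoc[symmetric])
  also have "\<dots> = inv y \<otimes> x"
    using x y' by (simp add: y'(2)[symmetric] m_assoc)
  finally show "inv y \<in> element_centralizer G x"
    using y' by (simp add: element_centralizer_def)
  fix w assume "w \<in> element_centralizer G x"
  with x y' show "y \<otimes> w \<in> element_centralizer G x"
    by (simp add: element_centralizer_def) (metis m_assoc)
qed (auto simp: element_centralizer_def)

text \<open>In this form the centre inherits the subgroup property from the centralizers.\<close>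

lemma group_center_eq_INT:
  "group_center G = (\<Inter>x\<in>carrier G. element_centralizer G x)"
  by (auto simp: group_center_def element_centralizer_def)

lemma subgroup_group_center: "subgroup (group_center G) G"
  unfolding group_center_eq_INT
  by (rule subgroups_Inter) (auto intro: subgroup_element_centralizer)

text \<open>By Lagrange the index \<open>m\<close> of \<open>H\<close> in \<open>K\<close> divides
  the order of \<open>G\<close>. It is not 1, so it has a prime factor, which is at least
  \<open>p\<close>.\<close>

lemma smallest_prime_mult_card_le:
  assumes fin: "finite (carrier G)"
    and smallest: "\<forall>q. prime q \<and> q dvd Coset.order G \<longrightarrow> p \<le> q"
    and H: "subgroup H G" and K: "subgroup K G" and HK: "H \<subset> K"
  shows "p * card H \<le> card K"
proof -
  interpret K: group "G\<lparr>carrier := K\<rparr>"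
    using K by (rule subgroup_imp_group)
  have "subgroup H (G\<lparr>carrier := K\<rparr>)"
    using subgroup_incl[OF H K] HK by blast
  from K.lagrange[OF this] obtain m where m: "m * card H = card K"
    by (auto simp: Coset.order_def)
  have "card H < card K"
    using HK K fin by (meson finite_subset psubset_card_mono subgroup.subset)
  with m have "m \<noteq> 1" by auto
  then obtain q where q: "prime q" "q dvd m"
    using prime_factor_nat by blast
  have "m dvd Coset.order G"
    using lagrange[OF K] m by (metis dvd_triv_left dvd_triv_right dvd_trans)
  with q smallest have "p \<le> q" by (meson dvd_trans)
  \<comment> \<open>Here \<open>m > 0\<close> is required: \<open>m = 0\<close> would make
    \<open>card K\<close> zero.\<close>
  moreover have "q \<le> m"
    using q m \<open>card H < card K\<close> by (intro dvd_imp_le) (auto intro: gr0I)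
  ultimately show ?thesis
    using m by (metis le_trans mult_le_mono1)
qed

section \<open>Commuting probability and the order of the centre\<close>

lemma card_commuting_pairs:
  assumes "finite (carrier G)"
  shows "card {(x, y) \<in> carrier G \<times> carrier G. x \<otimes> y = y \<otimes> x}
           = (\<Sum>x\<in>carrier G. card (element_centralizer G x))"
proof -
  have "{(x, y) \<in> carrier G \<times> carrier G. x \<otimes> y = y \<otimes> x}
          = (SIGMA x:carrier G. element_centralizer G x)"
    by (auto simp: element_centralizer_def)
  moreover have "finite (element_centralizer G x)" for x
    using assms by (simp add: element_centralizer_def)
  ultimately show ?thesis
    using assms by (simp add: card_SigmaI)
qed

lemma group_center_subset_element_centralizer:
  "x \<in> carrier G \<Longrightarrow> group_center G \<subseteq> element_centralizer G x"
  by (auto simp: group_center_eq_INT)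

lemma element_centralizer_psubset_carrier:
  "x \<in> carrier G - group_center G \<Longrightarrow> element_centralizer G x \<subset> carrier G"
  by (auto simp: element_centralizer_def group_center_def)

text \<open>Central elements contribute \<open>n\<close> to the count of commuting pairs, the others
  at most \<open>n / P\<close>. The fraction in \<open>Pr\<close> is what this bound gives, after
  division by the square of \<open>n\<close>, when \<open>n\<close> equals
  \<open>P\<^sup>2 * z\<close>; a larger \<open>n\<close> would make the bound too small.\<close>

lemma order_le_square_mult_card_group_center:
  assumes fin: "finite (carrier G)"
    and p: "prime p" and smallest: "\<forall>q. prime q \<and> q dvd Coset.order G \<longrightarrow> p \<le> q"
    and Pr: "(real p ^ 2 + real p - 1) / real p ^ 3 \<le> commuting_probability G"
  shows "Coset.order G \<le> p\<^sup>2 * card (group_center G)"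
proof -
  define n z P where "n = real (Coset.order G)" and "z = real (card (group_center G))" and "P = real p"
  have P: "P > 1" using prime_gt_1_nat[OF p] by (simp add: P_def)
  have n: "n > 0" using fin order_gt_0_iff_finite by (simp add: n_def)
  let ?c = "\<lambda>x. real (card (element_centralizer G x))"
  have sub: "group_center G \<subseteq> carrier G" by (auto simp: group_center_def)
  have noncentral: "?c x \<le> n / P" if "x \<in> carrier G - group_center G" for x
  proof -
    have "p * card (element_centralizer G x) \<le> Coset.order G"
      using smallest_prime_mult_card_le[OF fin smallest subgroup_element_centralizer subgroup_self]
        element_centralizer_psubset_carrier[OF that] that by (simp add: Coset.order_def)
    then have "P * ?c x \<le> n" unfolding P_def n_def by (metis of_nat_le_iff of_nat_mult)
    then show ?thesis using P by (simp add: field_simps)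
  qed
  have "commuting_probability G * n\<^sup>2 = (\<Sum>x\<in>carrier G. ?c x)"
    using n unfolding commuting_probability_def card_commuting_pairs[OF fin] n_def by simp
  also have "\<dots> = (\<Sum>x\<in>carrier G - group_center G. ?c x) + (\<Sum>x\<in>group_center G. ?c x)"
    by (rule sum.subset_diff[OF sub fin])
  also have "(\<Sum>x\<in>group_center G. ?c x) = z * n"
  proof -
    have "?c x = n" if "x \<in> group_center G" for x
    proof -
      have "element_centralizer G x = carrier G"
        using that by (auto simp: element_centralizer_def group_center_def)
      then show ?thesis by (simp add: n_def Coset.order_def)
    qed
    then show ?thesis by (simp add: z_def)
  qed
  also have "(\<Sum>x\<in>carrier G - group_center G. ?c x)
      \<le> real (card (carrier G - group_center G)) * (n / P)"
    using noncentral by (rule sum_bounded_above)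
  also have "real (card (carrier G - group_center G)) = n - z"
    using sub fin by (simp add: n_def z_def Coset.order_def card_Diff_subset finite_subset
        of_nat_diff card_mono)
  finally have "commuting_probability G * n\<^sup>2 \<le> (n - z) * (n / P) + z * n" by simp
  moreover have "(P\<^sup>2 + P - 1) / P ^ 3 * n\<^sup>2 \<le> commuting_probability G * n\<^sup>2"
    using Pr by (intro mult_right_mono) (auto simp: P_def)
  ultimately have "(P\<^sup>2 + P - 1) / P ^ 3 * n\<^sup>2 \<le> (n - z) * (n / P) + z * n" by linarith
  then have "(P\<^sup>2 + P - 1) / P ^ 3 * n\<^sup>2 * P ^ 3 \<le> ((n - z) * (n / P) + z * n) * P ^ 3"
    using P by (intro mult_right_mono) auto
  moreover have "(P\<^sup>2 + P - 1) / P ^ 3 * n\<^sup>2 * P ^ 3 = n * ((P\<^sup>2 + P - 1) * n)"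
    using P by (simp add: power2_eq_square)
  moreover have "((n - z) * (n / P) + z * n) * P ^ 3 = n * (P\<^sup>2 * (n - z) + P ^ 3 * z)"
    using P by (simp add: field_simps power2_eq_square power3_eq_cube)
  ultimately have "n * ((P\<^sup>2 + P - 1) * n) \<le> n * (P\<^sup>2 * (n - z) + P ^ 3 * z)"
    by simp
  then have "(P\<^sup>2 + P - 1) * n \<le> P\<^sup>2 * (n - z) + P ^ 3 * z"
    using n by simp
  \<comment> \<open>Subtracting \<open>P\<^sup>2 * n\<close> from both sides leaves the common
    factor \<open>P - 1\<close>, which is positive.\<close>
  then have "(P - 1) * n \<le> (P - 1) * (P\<^sup>2 * z)"
    by (simp add: algebra_simps power2_eq_square power3_eq_cube)
  then have "n \<le> P\<^sup>2 * z" using P by simp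
  then show ?thesis unfolding n_def P_def z_def
    by (metis of_nat_le_iff of_nat_mult of_nat_power)
qed

text \<open>The order of \<open>?C y\<close> is at most \<open>p * card ?Z\<close>, and that of
  \<open>?C x \<inter> ?C y\<close> is at least as much. Hence \<open>?C y\<close> lies in
  \<open>?C x\<close>, and \<open>w\<close> with it.\<close>

lemma commuting_transitive_on_noncentral:
  assumes fin: "finite (carrier G)"
    and p: "prime p" and smallest: "\<forall>q. prime q \<and> q dvd Coset.order G \<longrightarrow> p \<le> q"
    and order: "Coset.order G \<le> p\<^sup>2 * card (group_center G)"
    and x: "x \<in> carrier G - group_center G" and y: "y \<in> carrier G - group_center G"
    and w: "w \<in> carrier G - group_center G"
    and xy: "x \<otimes> y = y \<otimes> x" and yw: "y \<otimes> w = w \<otimes> y"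
  shows "x \<otimes> w = w \<otimes> x"
proof -
  let ?C = "element_centralizer G" and ?Z = "group_center G"
  note le = smallest_prime_mult_card_le[OF fin smallest]
  have subgroups: "subgroup (?C x) G" "subgroup (?C y) G" "subgroup (?C x \<inter> ?C y) G"
    using x y subgroup_element_centralizer by (auto intro: subgroups_Inter_pair)
  have "p * card (?C y) \<le> Coset.order G"
    using le[OF subgroups(2) subgroup_self] element_centralizer_psubset_carrier[OF y]
    by (simp add: Coset.order_def)
  with order have "p * card (?C y) \<le> p * (p * card ?Z)"
    by (metis le_trans mult.assoc power2_eq_square)
  then have "card (?C y) \<le> p * card ?Z"
    using prime_gt_0_nat[OF p] nat_mult_le_cancel1 by blast
  \<comment> \<open>The inclusion is strict because the non-central \<open>x\<close> lies in the
    intersection.\<close>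
  also have "?Z \<subset> ?C x \<inter> ?C y"
  proof -
    have "x \<in> ?C x \<inter> ?C y" using x xy by (auto simp: element_centralizer_def)
    then show ?thesis
      using x y group_center_subset_element_centralizer by blast
  qed
  then have "p * card ?Z \<le> card (?C x \<inter> ?C y)"
    using le[OF subgroup_group_center subgroups(3)] by blast
  finally have "?C x \<inter> ?C y = ?C y"
    using fin by (intro card_seteq) (auto simp: element_centralizer_def)
  moreover have "w \<in> ?C y" using w yw by (simp add: element_centralizer_def)
  ultimately show ?thesis by (auto simp: element_centralizer_def)
qed

end

theorem proposition5p6:
  fixes G :: "('a, 'b) monoid_scheme" and p :: nat
  assumes "group G"
    and "finite (carrier G)"
    and "prime p"
    and "p dvd Coset.order G"
    and "\<forall>q. prime q \<and> q dvd Coset.order G \<longrightarrow> p \<le> q"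
    and "commuting_probability G = (real p ^ 2 + real p - 1) / real p ^ 3"
  shows "L_integral (non_commuting_graph G)"
proof (rule L_integral_if_non_adjacency_transitive)
  show "pair_graph (non_commuting_graph G)"
    by (rule pair_graph_non_commuting_graph) fact
  interpret group G by fact
  have order: "Coset.order G \<le> p\<^sup>2 * card (group_center G)"
    by (rule order_le_square_mult_card_group_center) (use assms in auto)
  fix x y w
  assume "x \<in> pverts (non_commuting_graph G)" "y \<in> pverts (non_commuting_graph G)"
    "w \<in> pverts (non_commuting_graph G)" "(x, y) \<notin> parcs (non_commuting_graph G)"
    "(y, w) \<notin> parcs (non_commuting_graph G)"
  \<comment> \<open>Between vertices, a missing arc means that the two elements commute.\<close>
  then show "(x, w) \<notin> parcs (non_commuting_graph G)"
    using commuting_transitive_on_noncentral[OF assms(2,3,5) order, of x y w]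
    by (auto simp: non_commuting_graph_def)
qed

end
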